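(* For $|q|<1$ and every integer $N\ge1$, the $N$-th colored Jones polynomial $J_N(q)$ of the $4_1$ knot is given by $$J_N(q)=f^{(0)}(1,q^N,\lambda,q),$$ for every $\lambda\in\mathbb C^\times\setminus q^{\mathbb Z}$ (in particular the right-hand side does not depend on $\lambda$).
   Context: Let $0<|q|<1$, $(y;q)_k=\prod_{i=0}^{k-1}(1-q^iy)$, $\theta(\lambda;q)=\sum_{k\in\mathbb Z}(-1)^kq^{k(k+1)/2}\lambda^k$. For $t,x\in\mathbb C^\times$ define $$f^{(0)}(t,x,\lambda,q)=\frac1{\theta(\lambda;q)}\sum_{k\in\mathbb Z}(-1)^kq^{k(k+1)/2}\lambda^k\,\mathcal B_0(q^k\lambda t,x,q),$$ where $\mathcal B_0(\xi,x,q)$ is the analytic continuation to $\xi\in\mathbb C\setminus q^{\mathbb Z_{\le0}}$ of the power series $\sum_{k\ge0}(qx;q)_k(qx^{-1};q)_k\xi^k$ (for $x=q^N$ this is a polynomial in $\xi$). The $N$-th colored Jones polynomial of $4_1$ (colored by the $N$-dimensional representation of $\mathfrak{sl}_2$ and normalised to be $1$ at the unknot) is $J_N(q)=\sum_{k=0}^{N-1}(-1)^kq^{-k(k+1)/2}(q^{1+N};q)_k(q^{1-N};q)_k$. *)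

theory Defs
  imports "HOL-Complex_Analysis.Complex_Analysis"
begin

definition qpoch :: "complex \<Rightarrow> complex \<Rightarrow> nat \<Rightarrow> complex" where
  "qpoch y q k = (\<Prod>i<k. 1 - q ^ i * y)"

(* k * (k + 1) is always even, so the integer division by 2 is exact. *)
definition theta :: "complex \<Rightarrow> complex \<Rightarrow> complex" where
  "theta l q = (\<Sum>\<^sub>\<infinity>k::int. (-1) powi k * q powi (k * (k + 1) div 2) * l powi k)"

(* For 0 < |q| < 1 the series converges on the unit disc, and the domain
   below is open, connected and contains that disc.  Hence a continuation is uniquely determined
   on this domain; the values of B0 at the points q^n with n <= 0 carry no meaning. *)
definition B0_continuation :: "complex \<Rightarrow> complex \<Rightarrow> (complex \<Rightarrow> complex) \<Rightarrow> bool" where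
  "B0_continuation x q g \<longleftrightarrow>
     g holomorphic_on (- {q powi n |n::int. n \<le> 0}) \<and>
     (\<forall>z\<in>ball 0 1. (\<lambda>k. qpoch (q * x) q k * qpoch (q * inverse x) q k * z ^ k) sums g z)"

definition B0 :: "complex \<Rightarrow> complex \<Rightarrow> complex \<Rightarrow> complex" where
  "B0 \<xi> x q = (SOME g. B0_continuation x q g) \<xi>"

definition f0 :: "complex \<Rightarrow> complex \<Rightarrow> complex \<Rightarrow> complex \<Rightarrow> complex" where
  "f0 t x l q =
     1 / theta l q *
     (\<Sum>\<^sub>\<infinity>k::int. (-1) powi k * q powi (k * (k + 1) div 2) * l powi k * B0 (q powi k * l * t) x q)"

(* The colored Jones polynomial of the figure-eight knot 4_1, normalised to be 1 at the unknot,
   in its cyclotomic (Habiro) form. *)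
definition colored_Jones_4_1 :: "nat \<Rightarrow> complex \<Rightarrow> complex" where
  "colored_Jones_4_1 N q =
     (\<Sum>k<N. (-1) ^ k * q powi (- (int k * (int k + 1) div 2)) *
        qpoch (q powi (1 + int N)) q k * qpoch (q powi (1 - int N)) q k)"

end

theory Submission
  imports Defs
begin

text \<open>
  For x = q^N the series defining B0 terminates, so B0 is a polynomial in \<xi> off the excluded points.
  Summing it monomial by monomial against the theta series gives the values theta (q^j l), and the
  functional equation of theta turns these into multiples of theta l, which leaves theta l times the
  cyclotomic sum for the colored Jones polynomial.

  It remains to divide by theta l, that is, to know that theta does not vanish off the powers of q.
  This comes from the Jacobi triple product: a finite product is expanded by the q-binomial
  theorem, and Tannery's theorem lets its length tend to infinity.
\<close>

section \<open>Limits and finite sums of series over the integers\<close>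

text \<open>Dominated convergence over the integers: the enumeration \<open>int_decode\<close> turns
  each unordered sum into an absolutely convergent series, to which Tannery's theorem
  applies.\<close>

lemma tendsto_infsum_int_dominated:
  fixes a :: "nat \<Rightarrow> int \<Rightarrow> complex" and M :: "int \<Rightarrow> real"
  assumes lim: "\<And>k. (\<lambda>n. a n k) \<longlonglongrightarrow> b k"
    and bound: "\<And>n k. norm (a n k) \<le> M k"
    and summ: "M summable_on UNIV"
  shows "(\<lambda>n. \<Sum>\<^sub>\<infinity>k. a n k) \<longlonglongrightarrow> (\<Sum>\<^sub>\<infinity>k. b k)"
proof -
  have M: "summable (\<lambda>j. M (int_decode j))"
    using summable_on_reindex_bij_betw[OF bij_int_decode, of M] summ
    by (auto intro: summable_on_imp_summable)
  have eq: "(\<Sum>\<^sub>\<infinity>k. f k) = (\<Sum>j. f (int_decode j))"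
    if "\<And>k. norm (f k) \<le> M k" for f :: "int \<Rightarrow> complex"
  proof -
    have s: "summable (\<lambda>j. norm (f (int_decode j)))"
      by (rule summable_comparison_test'[OF M, of 0]) (use that in auto)
    have "((\<lambda>j. f (int_decode j)) has_sum (\<Sum>j. f (int_decode j))) UNIV"
      using s by (intro norm_summable_imp_has_sum) (auto dest: summable_norm_cancel)
    then have "(\<Sum>j. f (int_decode j)) = (\<Sum>\<^sub>\<infinity>j. f (int_decode j))"
      by (simp add: infsumI)
    also have "\<dots> = (\<Sum>\<^sub>\<infinity>k. f k)"
      by (rule infsum_reindex_bij_betw[OF bij_int_decode])
    finally show ?thesis by simp
  qed
  have b: "norm (b k) \<le> M k" for k
    by (rule LIMSEQ_le_const2[OF tendsto_norm[OF lim]]) (use bound in auto)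
  have "(\<lambda>n. \<Sum>j. a n (int_decode j)) \<longlonglongrightarrow> (\<Sum>j. b (int_decode j))"
    using tannerys_theorem[where a = "\<lambda>j n. a n (int_decode j)" and b = "\<lambda>j. b (int_decode j)"
        and F = sequentially and M = "\<lambda>j. M (int_decode j)"] lim bound M
    by (simp add: case_prod_unfold)
  then show ?thesis
    using eq bound b by simp
qed

lemma has_sum_finite_sum:
  fixes f :: "'i \<Rightarrow> 'a \<Rightarrow> 'b :: {topological_comm_monoid_add}"
  assumes "\<And>i. i \<in> I \<Longrightarrow> (f i has_sum s i) A"
  shows "((\<lambda>x. \<Sum>i\<in>I. f i x) has_sum (\<Sum>i\<in>I. s i)) A"
  using assms by (induction I rule: infinite_finite_induct) (auto intro!: has_sum_add)

subsection \<open>The terms of the theta series\<close>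

definition theta_term :: "complex \<Rightarrow> complex \<Rightarrow> int \<Rightarrow> complex" where
  "theta_term l q k = (-1) powi k * q powi (k * (k + 1) div 2) * l powi k"

lemma theta_eq_infsum_theta_term: "theta l q = (\<Sum>\<^sub>\<infinity>k. theta_term l q k)"
  by (simp add: theta_def theta_term_def)

lemma theta_term_0 [simp]: "theta_term l q 0 = 1"
  by (simp add: theta_term_def)

lemma theta_term_nonzero: "q \<noteq> 0 \<Longrightarrow> l \<noteq> 0 \<Longrightarrow> theta_term l q k \<noteq> 0"
  by (simp add: theta_term_def)

text \<open>The triangular exponent grows by k + 1 from one index to the next. This recursion drives
  the ratio test, the functional equation of \<open>theta\<close> and the finite triple
  product.\<close>

lemma theta_term_plus_1:
  assumes "q \<noteq> 0" "l \<noteq> 0"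
  shows "theta_term l q (k + 1) = - (q powi (k + 1) * l) * theta_term l q k"
proof -
  have "(k + 1) * (k + 1 + 1) = k * (k + 1) + (k + 1) * 2"
    by (simp add: algebra_simps)
  then have "(k + 1) * (k + 1 + 1) div 2 = k * (k + 1) div 2 + (k + 1)"
    by simp
  then show ?thesis
    using assms unfolding theta_term_def by (simp add: power_int_add field_simps)
qed

text \<open>The map k -> -1 - k preserves k(k+1), so the negative half of the series at
  \<open>l\<close> becomes the nonnegative half at \<open>inverse l\<close>.\<close>

lemma theta_term_reflect:
  assumes "l \<noteq> 0"
  shows "theta_term l q (- 1 - k) = - inverse l * theta_term (inverse l) q k"
proof -
  have "(- 1 - k) * (- 1 - k + 1) = k * (k + 1)"
    by (simp add: algebra_simps)
  then show ?thesis
    using assms unfolding theta_term_def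
    by (simp add: power_int_diff power_int_minus power_int_inverse field_simps)
qed

text \<open>The factor q^(jk) is what a monomial of degree j contributes at the point q^k l; a shift
  of the argument of theta absorbs it.\<close>

lemma theta_term_mult_power:
  "theta_term (q ^ j * l) q k = q powi (int j * k) * theta_term l q k"
  by (simp add: theta_term_def power_int_mult_distrib power_int_power)

text \<open>The ratio of consecutive terms is -q^(m+1) l, which tends to 0 for every
  \<open>l\<close>; hence it is eventually below 1/2 in norm.\<close>

lemma theta_term_summable_nat:
  assumes "0 < norm q" "norm q < 1" "l \<noteq> 0"
  shows "summable (\<lambda>m. norm (theta_term l q (int m)))"
proof -
  have "(\<lambda>m. q ^ Suc m * l) \<longlonglongrightarrow> 0 * l"
    by (intro tendsto_mult_right LIMSEQ_Suc LIMSEQ_power_zero) (use assms in auto)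
  then have "\<forall>\<^sub>F m in sequentially. norm (q ^ (m + 1) * l) < 1 / 2"
    using order_tendstoD(2)[OF tendsto_norm, of "\<lambda>m. q ^ Suc m * l" "0 * l" _ "1 / 2"] by simp
  then obtain N where N: "norm (q ^ (m + 1) * l) < 1 / 2" if "m \<ge> N" for m
    by (auto simp: eventually_sequentially)
  show ?thesis
  proof (rule summable_ratio_test[of "1 / 2" N])
    fix m assume "N \<le> m"
    have "theta_term l q (int (Suc m)) = - (q ^ (m + 1) * l) * theta_term l q (int m)"
      using theta_term_plus_1[of q l "int m"] assms
      by (simp add: add.commute flip: power_int_of_nat)
    then have "norm (theta_term l q (int (Suc m)))
        = norm (q ^ (m + 1) * l) * norm (theta_term l q (int m))"
      by (simp only: norm_mult norm_minus_cancel)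
    also have "\<dots> \<le> 1 / 2 * norm (theta_term l q (int m))"
      using N[OF \<open>N \<le> m\<close>] by (intro mult_right_mono) auto
    finally show "norm (norm (theta_term l q (int (Suc m))))
        \<le> 1 / 2 * norm (norm (theta_term l q (int m)))"
      by simp
  qed simp
qed

lemma theta_term_abs_summable:
  assumes "0 < norm q" "norm q < 1" "l \<noteq> 0"
  shows "(\<lambda>k. norm (theta_term l q k)) summable_on UNIV"
proof -
  have 1: "(\<lambda>k. norm (theta_term l q k)) summable_on range int"
    using theta_term_summable_nat[OF assms]
    by (subst summable_on_reindex) (auto simp: o_def intro: norm_summable_imp_summable_on)
  have 2: "(\<lambda>k. norm (theta_term l q k)) summable_on range (\<lambda>m. - 1 - int m)"
    using theta_term_summable_nat[of q "inverse l"] assms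
    by (subst summable_on_reindex)
       (auto simp: inj_on_def o_def theta_term_reflect norm_mult
             intro!: norm_summable_imp_summable_on summable_mult)
  have "k \<in> range int \<union> range (\<lambda>m. - 1 - int m)" for k
  proof (cases "k \<ge> 0")
    case True
    then show ?thesis by (auto intro: range_eqI[of _ _ "nat k"])
  next
    case False
    then show ?thesis by (auto intro: range_eqI[of _ _ "nat (- 1 - k)"])
  qed
  then have "UNIV = range int \<union> range (\<lambda>m. - 1 - int m)" by auto
  then show ?thesis
    using 1 2 by (metis summable_on_union)
qed

lemma theta_term_summable:
  assumes "0 < norm q" "norm q < 1" "l \<noteq> 0"
  shows "theta_term l q summable_on UNIV"
  using theta_term_abs_summable[OF assms] by (rule abs_summable_summable)

text \<open>The functional equation is a shift of the summation index by one. Reindexing and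
  extraction of a constant are valid even for the default value of a divergent
  \<open>infsum\<close>.\<close>

lemma theta_mult_q:
  assumes "q \<noteq> 0" "l \<noteq> 0"
  shows "theta l q = - (q * l) * theta (q * l) q"
proof -
  have "theta l q = (\<Sum>\<^sub>\<infinity>k. theta_term l q (k + 1))"
    unfolding theta_eq_infsum_theta_term
    by (rule infsum_reindex_bij_betw[symmetric]) (rule bij_plus_right)
  also have "\<dots> = (\<Sum>\<^sub>\<infinity>k. - (q * l) * theta_term (q * l) q k)"
    using theta_term_mult_power[of q 1 l] assms
    by (simp add: theta_term_plus_1 power_int_add mult_ac)
  also have "\<dots> = - (q * l) * theta (q * l) q"
    unfolding theta_eq_infsum_theta_term by (rule infsum_cmult_right')
  finally show ?thesis .
qed

text \<open>Iterating the functional equation j times accumulates exactly the j-th term of the theta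
  series as the factor.\<close>

lemma theta_term_mult_theta:
  assumes "q \<noteq> 0" "l \<noteq> 0"
  shows "theta_term l q (int j) * theta (q ^ j * l) q = theta l q"
proof (induction j)
  case (Suc j)
  have "theta_term l q (int (Suc j)) * theta (q ^ Suc j * l) q
      = theta_term l q (int j) * (- (q * (q ^ j * l)) * theta (q * (q ^ j * l)) q)"
    using theta_term_plus_1[OF assms, of "int j"] assms
    by (simp add: power_int_add mult_ac add.commute)
  also have "\<dots> = theta_term l q (int j) * theta (q ^ j * l) q"
    using theta_mult_q[of q "q ^ j * l"] assms by simp
  finally show ?case
    using Suc by simp
qed simp

subsection \<open>Infinite products and the zeros of theta\<close>

lemma qpoch_Suc: "qpoch y q (Suc m) = qpoch y q m * (1 - q ^ m * y)"
  by (simp add: qpoch_def)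

lemma qpoch_add: "qpoch y q (m + n) = qpoch y q m * qpoch (q ^ m * y) q n"
  by (induction n) (simp_all add: qpoch_Suc qpoch_def[of _ _ 0] power_add mult_ac)

text \<open>A geometric series gives absolute convergence of the product, and a convergent product
  without zero factors has a nonzero limit.\<close>

lemma qpoch_tendsto:
  assumes "norm q < 1" and nz: "\<And>i. q ^ i * y \<noteq> 1"
  shows "\<exists>L. L \<noteq> 0 \<and> qpoch y q \<longlonglongrightarrow> L"
proof -
  have "abs_convergent_prod (\<lambda>i. 1 - q ^ i * y)"
    unfolding abs_convergent_prod_conv_summable
    using assms by (auto simp: norm_mult norm_power intro!: summable_mult2 summable_geometric)
  then have "convergent_prod (\<lambda>i. 1 - q ^ i * y)"
    by (rule abs_convergent_prod_imp_convergent_prod)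
  moreover have "1 - q ^ i * y \<noteq> 0" for i
    using nz[of i] by auto
  ultimately obtain L where "L \<noteq> 0" "(\<lambda>n. \<Prod>i\<le>n. 1 - q ^ i * y) \<longlonglongrightarrow> L"
    by (auto simp: convergent_prod_iff_nz_lim)
  then have "(\<lambda>n. qpoch y q (Suc n)) \<longlonglongrightarrow> L"
    by (simp add: qpoch_def lessThan_Suc_atMost)
  then have "qpoch y q \<longlonglongrightarrow> L"
    by (rule LIMSEQ_imp_Suc)
  then show ?thesis using \<open>L \<noteq> 0\<close> by blast
qed

section \<open>Gaussian binomial coefficients and the q-binomial theorem\<close>

text \<open>The exponent m - k in the recursion is a genuine difference wherever it matters: for k > m the
  factor qbinomial q m k vanishes.\<close>

fun qbinomial :: "complex \<Rightarrow> nat \<Rightarrow> nat \<Rightarrow> complex" where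
  "qbinomial q m 0 = 1"
| "qbinomial q 0 (Suc k) = 0"
| "qbinomial q (Suc m) (Suc k) = qbinomial q m (Suc k) + q ^ (m - k) * qbinomial q m k"

lemma qbinomial_eq_0: "m < k \<Longrightarrow> qbinomial q m k = 0"
  by (induction q m k rule: qbinomial.induct) auto

text \<open>The quotient formula with denominators cleared, so that it holds for every
  \<open>q\<close>. The inductive step rests on (1 - q^(r+1)) + q^(r+1) (1 - q^(k+1)) = 1 - q^(m+1),
  where m = r + k + 1.\<close>

lemma qbinomial_qpoch:
  "k \<le> m \<Longrightarrow> qbinomial q m k * qpoch q q k * qpoch q q (m - k) = qpoch q q m"
proof (induction q m k rule: qbinomial.induct)
  case (3 q m k)
  show ?case
  proof (cases "k = m")
    case True
    then have "qbinomial q m m * qpoch q q m = qpoch q q m"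
      using 3 by (simp add: qpoch_def[of _ _ 0])
    then show ?thesis
      using True by (simp add: qbinomial_eq_0 qpoch_Suc qpoch_def[of _ _ 0] flip: mult.assoc)
  next
    case False
    then have k: "Suc k \<le> m" using 3 by simp
    define r where "r = m - Suc k"
    have r: "m = Suc (r + k)" "m - k = Suc r" "Suc m - Suc k = Suc r"
      using k by (auto simp: r_def)
    have IH1: "qbinomial q m (Suc k) * qpoch q q (Suc k) * qpoch q q r = qpoch q q m"
      using 3 k by (simp add: r_def)
    have IH2: "qbinomial q m k * qpoch q q k * qpoch q q (Suc r) = qpoch q q m"
      using 3 k r by simp
    have "qbinomial q (Suc m) (Suc k) * qpoch q q (Suc k) * qpoch q q (Suc m - Suc k)
        = (qbinomial q m (Suc k) * qpoch q q (Suc k) * qpoch q q r) * (1 - q ^ r * q)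
          + q ^ Suc r * (qbinomial q m k * qpoch q q k * qpoch q q (Suc r)) * (1 - q ^ k * q)"
      unfolding r(3) qbinomial.simps r(2) qpoch_Suc by (simp add: algebra_simps)
    also have "\<dots> = qpoch q q m * (1 - q ^ m * q)"
      unfolding IH1 IH2 by (simp add: r(1) algebra_simps power_add)
    finally show ?thesis
      by (simp only: qpoch_Suc)
  qed
qed (auto simp: qpoch_def)

text \<open>The q-binomial theorem, by splitting off the last factor 1 - q^m y and matching
  coefficients with the recursion of \<open>qbinomial\<close>.\<close>

lemma qpoch_eq_sum_qbinomial:
  "qpoch y q m = (\<Sum>k\<le>m. (-1) ^ k * q ^ (k choose 2) * y ^ k * qbinomial q m k)"
proof (induction m)
  case (Suc m)
  define t where "t m k = (-1) ^ k * q ^ (k choose 2) * y ^ k * qbinomial q m k" for m k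
  have ch: "Suc k choose 2 = k + (k choose 2)" for k
    by (simp add: numeral_2_eq_2)
  have step: "t (Suc m) (Suc k) = t m (Suc k) - q ^ m * y * t m k" if "k \<le> m" for k
  proof -
    have "q ^ m = q ^ k * q ^ (m - k)"
      using that by (simp flip: power_add)
    then show ?thesis
      by (simp add: t_def ch power_add algebra_simps)
  qed
  have "(\<Sum>k\<le>Suc m. t (Suc m) k) = t (Suc m) 0 + (\<Sum>k\<le>m. t (Suc m) (Suc k))"
    by (rule sum.atMost_Suc_shift)
  also have "\<dots> = t m 0 + (\<Sum>k\<le>m. t m (Suc k)) - q ^ m * y * (\<Sum>k\<le>m. t m k)"
    using step by (simp add: t_def sum_subtractf sum_distrib_left)
  also have "t m 0 + (\<Sum>k\<le>m. t m (Suc k)) = (\<Sum>k\<le>Suc m. t m k)"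
    by (rule sum.atMost_Suc_shift[symmetric])
  also have "\<dots> = (\<Sum>k\<le>m. t m k)"
    by (simp add: t_def qbinomial_eq_0)
  finally show ?case
    using Suc unfolding t_def[symmetric] by (simp add: qpoch_Suc algebra_simps)
qed (simp add: qpoch_def binomial_eq_0)

text \<open>The q-binomial theorem with 2n factors at y = q^(1-n) l, divided by the constant C n that
  comes from inverting the first n factors.\<close>

lemma finite_triple_product:
  assumes "q \<noteq> 0" "l \<noteq> 0"
  shows "qpoch (q * l) q n * qpoch (inverse l) q n
    = (\<Sum>k\<le>2*n. theta_term l q (int k - int n) * qbinomial q (2 * n) k)"
proof -
  define y where "y = q powi (1 - int n) * l"
  define C where "C = (\<lambda>n. \<Prod>i<n. - (l / q ^ i))"
  have "C n \<noteq> 0"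
    using assms by (simp add: C_def)
  \<comment> \<open>Thus \<open>C n\<close> is the reciprocal of the leftmost theta term, which
    settles the case k = 0 of the next claim.\<close>
  have C: "C n * theta_term l q (- int n) = 1" for n
  proof (induction n)
    case (Suc n)
    have "theta_term l q (- int n) = - (l / q ^ n) * theta_term l q (- int (Suc n))"
      using theta_term_plus_1[OF assms, of "- int (Suc n)"]
      by (simp add: power_int_minus divide_inverse)
    then show ?case
      using Suc by (simp add: C_def mult.assoc)
  qed (simp add: C_def)
  \<comment> \<open>Up to \<open>C n\<close>, the monomials of the q-binomial theorem are theta
    terms shifted by n: both sides are multiplied by -q^k y = -q^(k-n+1) l as k increases.\<close>
  have tm: "(-1) ^ k * q ^ (k choose 2) * y ^ k = C n * theta_term l q (int k - int n)" for k
  proof (induction k)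
    case (Suc k)
    have ch: "Suc k choose 2 = k + (k choose 2)"
      by (simp add: numeral_2_eq_2)
    have e: "q powi (int k - int n + 1) = q ^ k * q powi (1 - int n)"
      using assms by (simp add: algebra_simps flip: power_int_of_nat power_int_add)
    have "(-1) ^ Suc k * q ^ (Suc k choose 2) * y ^ Suc k
        = - (q ^ k * y) * ((-1) ^ k * q ^ (k choose 2) * y ^ k)"
      by (simp add: ch power_add)
    also have "\<dots> = C n * (- (q powi (int k - int n + 1) * l) * theta_term l q (int k - int n))"
      unfolding Suc e by (simp add: y_def)
    also have "\<dots> = C n * theta_term l q (int k - int n + 1)"
      by (simp add: theta_term_plus_1[OF assms])
    finally show ?case by (simp add: algebra_simps)
  qed (simp add: C binomial_eq_0)
  \<comment> \<open>In reversed order the first n factors are 1 - l/q^i, each of which is inverted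
    to -(l/q^i)(1 - q^i/l).\<close>
  have "qpoch y q n = (\<Prod>i<n. 1 - q ^ (n - Suc i) * y)"
    unfolding qpoch_def by (rule prod.nat_diff_reindex[symmetric])
  also have "\<dots> = (\<Prod>i<n. - (l / q ^ i) * (1 - q ^ i * inverse l))"
  proof (rule prod.cong[OF refl])
    fix i assume "i \<in> {..<n}"
    then have "q ^ (n - Suc i) * q powi (1 - int n) = q powi (- int i)"
      using assms by (simp add: of_nat_diff flip: power_int_of_nat power_int_add)
    then have "q ^ (n - Suc i) * y = l / q ^ i"
      by (simp add: y_def power_int_minus field_simps)
    then show "1 - q ^ (n - Suc i) * y = - (l / q ^ i) * (1 - q ^ i * inverse l)"
      using assms by (simp add: field_simps)
  qed
  also have "\<dots> = C n * qpoch (inverse l) q n"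
    unfolding C_def qpoch_def by (rule prod.distrib)
  finally have lower: "qpoch y q n = C n * qpoch (inverse l) q n" .
  \<comment> \<open>The remaining n factors start at q l.\<close>
  have qn: "q ^ n * y = q * l"
    using assms by (simp add: y_def power_int_diff)
  have "C n * (qpoch (q * l) q n * qpoch (inverse l) q n) = qpoch y q (2 * n)"
    using qpoch_add[of y q n n] by (simp add: lower qn mult_2)
  also have "\<dots> = C n * (\<Sum>k\<le>2*n. theta_term l q (int k - int n) * qbinomial q (2 * n) k)"
    unfolding qpoch_eq_sum_qbinomial tm by (simp add: sum_distrib_left mult_ac)
  finally show ?thesis
    using \<open>C n \<noteq> 0\<close> by simp
qed

text \<open>In the limit, theta is the product of three infinite q-Pochhammer symbols, at q, q l and
  1/l. A factor of the second vanishes only at l = q^(-i-1), one of the third only at l = q^i, and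
  none of the first vanishes.\<close>

lemma theta_nonzero:
  assumes q: "0 < norm q" "norm q < 1" and l: "l \<noteq> 0" "l \<notin> {q powi n |n::int. True}"
  shows "theta l q \<noteq> 0"
proof -
  have q0: "q \<noteq> 0" using q by auto
  have pow_ne: "q ^ Suc i \<noteq> 1" for i
    using q by (metis norm_one norm_power power_Suc_less_one order.irrefl norm_ge_zero)
  have ne1: "q ^ i * (q * l) \<noteq> 1" for i
  proof
    assume "q ^ i * (q * l) = 1"
    then have "inverse (q ^ Suc i) = l"
      by (intro inverse_unique) (simp add: mult_ac)
    then have "l = q powi (- int (Suc i))"
      by (simp only: power_int_minus power_int_of_nat)
    then show False using l by blast
  qed
  have ne2: "q ^ i * inverse l \<noteq> 1" for i
  proof
    assume "q ^ i * inverse l = 1"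
    then have "l = q powi (int i)"
      using l by (simp add: field_simps)
    then show False using l by blast
  qed
  obtain L where L: "L \<noteq> 0" "qpoch q q \<longlonglongrightarrow> L"
    using qpoch_tendsto[of q q] q pow_ne by (auto simp: mult.commute)
  obtain L1 where L1: "L1 \<noteq> 0" "qpoch (q * l) q \<longlonglongrightarrow> L1"
    using qpoch_tendsto[OF q(2) ne1] by blast
  obtain L2 where L2: "L2 \<noteq> 0" "qpoch (inverse l) q \<longlonglongrightarrow> L2"
    using qpoch_tendsto[OF q(2) ne2] by blast
  have P_ne: "qpoch q q k \<noteq> 0" for k
    using pow_ne by (auto simp: qpoch_def mult.commute)
  \<comment> \<open>Since \<open>qpoch q q\<close> has a nonzero limit, it and its inverse are
    bounded; this bounds all q-binomial coefficients uniformly and supplies the dominating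
    series.\<close>
  obtain B where B: "norm (qpoch q q k) \<le> B" for k
    using convergent_imp_Bseq[of "qpoch q q"] L by (auto simp: convergent_def Bseq_def)
  have "Bseq (\<lambda>k. inverse (qpoch q q k))"
    using L by (intro convergent_imp_Bseq convergentI[OF tendsto_inverse]) auto
  then obtain B' where B': "norm (inverse (qpoch q q k)) \<le> B'" for k
    by (auto simp: Bseq_def)
  have "0 \<le> B" "0 \<le> B'"
    using B[of 0] B'[of 0] norm_ge_zero order_trans by blast+
  have gb: "qbinomial q m k = qpoch q q m * inverse (qpoch q q k) * inverse (qpoch q q (m - k))"
    if "k \<le> m" for m k
    using qbinomial_qpoch[OF that, of q] P_ne by (simp add: field_simps)
  have gb_bound: "norm (qbinomial q m k) \<le> B * B' * B'" for m k
  proof (cases "k \<le> m")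
    case True
    then show ?thesis
      unfolding gb[OF True] norm_mult
      by (intro mult_mono B B') (auto simp: \<open>0 \<le> B\<close> \<open>0 \<le> B'\<close>)
  qed (auto simp: qbinomial_eq_0 \<open>0 \<le> B\<close> \<open>0 \<le> B'\<close>)
  \<comment> \<open>Coefficients recentred at the middle and extended by 0, so that all finite sums
    run over the same index set of integers.\<close>
  define g where "g n k = (if - int n \<le> k \<and> k \<le> int n then qbinomial q (2 * n) (nat (k + int n)) else 0)"
    for n :: nat and k :: int
  have g_lim: "(\<lambda>n. g n k) \<longlonglongrightarrow> inverse L" for k
  proof -
    have ev: "\<forall>\<^sub>F n in sequentially. nat \<bar>k\<bar> \<le> n"
      by (rule eventually_ge_at_top)
    have f1: "filterlim (\<lambda>n::nat. 2 * n) at_top sequentially"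
      by (rule filterlim_subseq) (simp add: strict_mono_def)
    have f2: "filterlim (\<lambda>n. nat (c + int n)) at_top sequentially" for c
      unfolding filterlim_at_top eventually_sequentially
    proof
      fix Z :: nat
      show "\<exists>N. \<forall>n\<ge>N. Z \<le> nat (c + int n)"
        by (rule exI[of _ "Z + nat \<bar>c\<bar>"]) linarith
    qed
    \<comment> \<open>As soon as n is at least the absolute value of k, this quotient is the
      q-binomial coefficient at (2n, n + k), with no truncation by \<open>nat\<close>.\<close>
    have "(\<lambda>n. qpoch q q (2 * n) * inverse (qpoch q q (nat (k + int n)))
            * inverse (qpoch q q (nat (- k + int n)))) \<longlonglongrightarrow> L * inverse L * inverse L"
      using L by (intro tendsto_intros filterlim_compose[OF L(2)] f1 f2)
    then have "(\<lambda>n. qpoch q q (2 * n) * inverse (qpoch q q (nat (k + int n)))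
            * inverse (qpoch q q (nat (- k + int n)))) \<longlonglongrightarrow> inverse L"
      using L by simp
    moreover have "\<forall>\<^sub>F n in sequentially. qpoch q q (2 * n) * inverse (qpoch q q (nat (k + int n)))
            * inverse (qpoch q q (nat (- k + int n))) = g n k"
      using ev
    proof eventually_elim
      case (elim n)
      then have "- int n \<le> k \<and> k \<le> int n" by linarith
      moreover from this have "nat (k + int n) \<le> 2 * n" "2 * n - nat (k + int n) = nat (- k + int n)"
        by linarith+
      ultimately show ?case
        by (simp add: g_def gb)
    qed
    ultimately show ?thesis
      by (rule Lim_transform_eventually)
  qed
  have "(\<lambda>n. \<Sum>\<^sub>\<infinity>k. theta_term l q k * g n k) \<longlonglongrightarrow> (\<Sum>\<^sub>\<infinity>k. theta_term l q k * inverse L)"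
  proof (rule tendsto_infsum_int_dominated)
    show "(\<lambda>k. norm (theta_term l q k) * (B * B' * B')) summable_on UNIV"
      using theta_term_abs_summable[OF q l(1)] by (rule summable_on_cmult_left)
    show "norm (theta_term l q k * g n k) \<le> norm (theta_term l q k) * (B * B' * B')" for n k
      using gb_bound \<open>0 \<le> B\<close> \<open>0 \<le> B'\<close> by (auto simp: norm_mult g_def intro!: mult_left_mono)
    show "(\<lambda>n. theta_term l q k * g n k) \<longlonglongrightarrow> theta_term l q k * inverse L" for k
      by (intro tendsto_intros g_lim)
  qed
  moreover have "(\<Sum>\<^sub>\<infinity>k. theta_term l q k * g n k) = qpoch (q * l) q n * qpoch (inverse l) q n" for n
  proof -
    have "(\<Sum>\<^sub>\<infinity>k. theta_term l q k * g n k) = (\<Sum>\<^sub>\<infinity>k\<in>{- int n..int n}. theta_term l q k * g n k)"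
      by (rule infsum_cong_neutral) (auto simp: g_def)
    also have "\<dots> = (\<Sum>k\<in>{- int n..int n}. theta_term l q k * g n k)"
      by simp
    also have "\<dots> = (\<Sum>k\<le>2*n. theta_term l q (int k - int n) * qbinomial q (2 * n) k)"
      by (rule sum.reindex_bij_witness[of _ "\<lambda>k. int k - int n" "\<lambda>k. nat (k + int n)"])
         (auto simp: g_def)
    finally show ?thesis
      by (simp add: finite_triple_product q0 l)
  qed
  ultimately have "(\<lambda>n. qpoch (q * l) q n * qpoch (inverse l) q n) \<longlonglongrightarrow> theta l q * inverse L"
    by (simp add: theta_eq_infsum_theta_term infsum_cmult_left')
  moreover have "(\<lambda>n. qpoch (q * l) q n * qpoch (inverse l) q n) \<longlonglongrightarrow> L1 * L2"
    by (intro tendsto_intros L1 L2)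
  ultimately have "theta l q * inverse L = L1 * L2"
    by (rule LIMSEQ_unique)
  then show ?thesis using L1 L2 by auto
qed

subsection \<open>The analytic continuation\<close>

text \<open>With r = 1/|q| > 1 the norms of the points are the powers r^m, so distinct points are at
  least r - 1 apart; a uniformly discrete set is closed.\<close>

lemma closed_nonpos_powi:
  fixes q :: complex
  assumes "0 < norm q" "norm q < 1"
  shows "closed {q powi n |n::int. n \<le> 0}"
proof (rule discrete_imp_closed)
  define r where "r = inverse (norm q)"
  have r: "r > 1" using assms by (simp add: r_def one_less_inverse_iff)
  then show "0 < r - 1" by simp
  have sep: "r - 1 \<le> dist (q powi a) (q powi b)" if "a < b" "b \<le> 0" for a b :: int
  proof -
    define m where "m = nat (- b)"
    define d where "d = nat (b - a) - 1"
    have b: "b = - int m" and a: "a = - int (m + Suc d)"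
      using that by (auto simp: m_def d_def)
    have "norm (q powi (- int k)) = r ^ k" for k
      by (simp only: power_int_minus power_int_of_nat norm_inverse norm_power r_def power_inverse)
    then have nb: "norm (q powi b) = r ^ m" and na: "norm (q powi a) = r ^ m * r ^ Suc d"
      unfolding a b by (simp_all only: power_add)
    have "r - 1 \<le> 1 * (r ^ Suc d - 1)"
      using r self_le_power[of r "Suc d"] by simp
    also have "\<dots> \<le> r ^ m * (r ^ Suc d - 1)"
      using r one_le_power[of r m] one_le_power[of r "Suc d"] by (intro mult_right_mono) auto
    also have "\<dots> = norm (q powi a) - norm (q powi b)"
      by (simp add: na nb algebra_simps)
    also have "\<dots> \<le> dist (q powi a) (q powi b)"
      by (simp add: dist_norm norm_triangle_ineq2)
    finally show ?thesis .
  qed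
  show "\<forall>x\<in>{q powi n |n::int. n \<le> 0}. \<forall>y\<in>{q powi n |n::int. n \<le> 0}. dist y x < r - 1 \<longrightarrow> y = x"
  proof clarify
    fix a b :: int
    assume ab: "a \<le> 0" "b \<le> 0" "dist (q powi b) (q powi a) < r - 1"
    show "q powi b = q powi a"
      using sep[of a b] sep[of b a] ab by (cases a b rule: linorder_cases) (auto simp: dist_commute)
  qed
qed

text \<open>The choice made by \<open>SOME\<close> is harmless here: two continuations agree on the
  unit disc, and the complement of a closed countable set in the plane is open and connected, so the
  identity theorem applies.\<close>

lemma B0_eqI:
  assumes q: "0 < norm q" "norm q < 1"
    and g: "B0_continuation x q g" and \<xi>: "\<xi> \<notin> {q powi n |n::int. n \<le> 0}"
  shows "B0 \<xi> x q = g \<xi>"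
proof -
  define S where "S = {q powi n |n::int. n \<le> 0}"
  define h where "h = (SOME g. B0_continuation x q g)"
  have h: "B0_continuation x q h"
    unfolding h_def by (rule someI[of _ g]) (rule g)
  have "S = (\<lambda>n. q powi n) ` {..0}"
    by (auto simp: S_def)
  then have "countable S" by simp
  have op: "open (- S)"
    using closed_nonpos_powi[OF q] by (simp add: S_def open_Compl)
  have con: "connected (- S)"
    using \<open>countable S\<close> by (intro path_connected_imp_connected path_connected_complement_countable) auto
  have "ball 0 1 \<subseteq> - S"
  proof
    fix z :: complex assume "z \<in> ball 0 1"
    moreover have "1 \<le> norm (q powi n)" if "n \<le> 0" for n
      using that q
      by (auto simp: power_int_def norm_power norm_inverse intro!: one_le_power one_le_inverse)
    ultimately show "z \<in> - S"
      unfolding S_def by force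
  qed
  moreover have "h z = g z" if "z \<in> ball 0 1" for z
    using that g h sums_unique2 unfolding B0_continuation_def by blast
  ultimately have "h \<xi> = g \<xi>"
    using g h \<xi> op con
    by (intro analytic_continuation_open[of "ball 0 1" "- S" h g \<xi>])
       (auto simp: B0_continuation_def S_def)
  then show ?thesis
    by (simp add: B0_def h_def)
qed

text \<open>The factor of index N - 1 in the symbol at q^(1-N) is 1 - 1 = 0. The series therefore
  stops before degree N, and the resulting polynomial is its own continuation.\<close>

lemma B0_terminating:
  assumes q: "0 < norm q" "norm q < 1" and "N \<ge> 1"
    and \<xi>: "\<xi> \<notin> {q powi n |n::int. n \<le> 0}"
  shows "B0 \<xi> (q ^ N) q
    = (\<Sum>j<N. qpoch (q powi (1 + int N)) q j * qpoch (q powi (1 - int N)) q j * \<xi> ^ j)"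
proof (rule B0_eqI[OF q _ \<xi>])
  have q0: "q \<noteq> 0" using q by auto
  have e1: "q * q ^ N = q powi (1 + int N)" and e2: "q * inverse (q ^ N) = q powi (1 - int N)"
    using q0 by (simp_all add: power_int_add power_int_diff divide_inverse)
  have zero: "qpoch (q powi (1 - int N)) q k = 0" if "N \<le> k" for k
  proof -
    have "q ^ (N - 1) * q powi (1 - int N) = 1"
      using q0 \<open>N \<ge> 1\<close> by (simp add: of_nat_diff flip: power_int_of_nat power_int_add)
    then show ?thesis
      unfolding qpoch_def using that \<open>N \<ge> 1\<close>
      by (intro prod_zero bexI[of _ "N - 1"]) auto
  qed
  show "B0_continuation (q ^ N) q (\<lambda>\<xi>. \<Sum>j<N. qpoch (q powi (1 + int N)) q j
      * qpoch (q powi (1 - int N)) q j * \<xi> ^ j)"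
    unfolding B0_continuation_def e1 e2
  proof (intro conjI ballI holomorphic_intros)
    show "(\<lambda>k. qpoch (q powi (1 + int N)) q k * qpoch (q powi (1 - int N)) q k * z ^ k)
        sums (\<Sum>j<N. qpoch (q powi (1 + int N)) q j * qpoch (q powi (1 - int N)) q j * z ^ j)" for z
      by (rule sums_finite) (auto simp: zero)
  qed
qed

section \<open>Evaluation of the theta-weighted sum at x = q^N\<close>

theorem theorem1p10:
  fixes q l :: complex and N :: nat
  assumes "0 < norm q" and "norm q < 1"
    and "N \<ge> 1"
    and "l \<noteq> 0" and "l \<notin> {q powi n |n::int. True}"
  shows "colored_Jones_4_1 N q = f0 1 (q ^ N) l q"
proof -
  define c where "c j = qpoch (q powi (1 + int N)) q j * qpoch (q powi (1 - int N)) q j" for j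
  have q0: "q \<noteq> 0" using assms by auto
  \<comment> \<open>Only meaningful values of \<open>B0\<close> enter, because \<open>l\<close> is
    not a power of \<open>q\<close>.\<close>
  have off: "q powi k * l \<notin> {q powi n |n::int. n \<le> 0}" for k
  proof
    assume "q powi k * l \<in> {q powi n |n::int. n \<le> 0}"
    then obtain n where "q powi k * l = q powi n" by blast
    then have "l = q powi (n - k)"
      using q0 by (simp add: power_int_diff field_simps)
    then show False using assms(5) by blast
  qed
  have tm: "theta_term l q k * B0 (q powi k * l * 1) (q ^ N) q
      = (\<Sum>j<N. c j * l ^ j * theta_term (q ^ j * l) q k)" for k
    unfolding theta_term_mult_power
    using B0_terminating[OF assms(1-3) off, of k]
    by (simp add: c_def sum_distrib_left power_mult_distrib power_int_power' mult_ac)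
  have "((\<lambda>k. c j * l ^ j * theta_term (q ^ j * l) q k) has_sum c j * l ^ j * theta (q ^ j * l) q) UNIV"
    for j
    unfolding theta_eq_infsum_theta_term using assms q0
    by (intro has_sum_cmult_right has_sum_infsum theta_term_summable) auto
  \<comment> \<open>The two sums may be exchanged since the inner one is finite and each theta
    series converges.\<close>
  then have "(\<Sum>\<^sub>\<infinity>k. theta_term l q k * B0 (q powi k * l * 1) (q ^ N) q)
      = (\<Sum>j<N. c j * l ^ j * theta (q ^ j * l) q)"
    unfolding tm by (intro infsumI has_sum_finite_sum)
  also have "\<dots> = (\<Sum>j<N. theta l q * ((-1) ^ j * q powi (- (int j * (int j + 1) div 2)) * c j))"
  proof (rule sum.cong[OF refl])
    fix j
    have "theta (q ^ j * l) q = theta l q / theta_term l q (int j)"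
      using theta_term_mult_theta[OF q0 assms(4), of j] theta_term_nonzero[OF q0 assms(4)]
      by (simp add: field_simps)
    then have "c j * l ^ j * theta (q ^ j * l) q = theta l q * (l ^ j / theta_term l q (int j) * c j)"
      by simp
    \<comment> \<open>Here l^j cancels, which is why the final value is independent of
      \<open>l\<close>.\<close>
    also have "l ^ j / theta_term l q (int j) = (-1) ^ j * q powi (- (int j * (int j + 1) div 2))"
      using assms(4) q0 by (simp add: theta_term_def power_int_minus field_simps flip: power_add)
    finally show "c j * l ^ j * theta (q ^ j * l) q
        = theta l q * ((-1) ^ j * q powi (- (int j * (int j + 1) div 2)) * c j)" .
  qed
  also have "\<dots> = theta l q * colored_Jones_4_1 N q"
    by (simp add: colored_Jones_4_1_def c_def sum_distrib_left mult_ac)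
  finally show ?thesis
    using theta_nonzero[OF assms(1,2,4,5)] by (simp add: f0_def theta_term_def)
qed

end
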